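(* Let $N_0$ be a positive integer, and consider a quadratic differential equation of the form $$\mathcal{D}_{\log t}^4f\cdot f+\mathcal{D}_{\log t}^2f\cdot f-4\mathcal{D}^2_{\log t}(\delta f)\cdot f +\sum_{N=1}^{N_0} t^N \sum_{K=0}^{4} \sum_{I=0}^{\lfloor K/2 \rfloor}\alpha_{N,K,I}\,\delta^I f \cdot \delta^{K-I}f=0,$$ with complex parameter $\sigma\notin\mathbb{Q}$. Suppose it is known that the formal solution of the equation has the form $$\tau (t)=\sum_{m\in \mathbb{Z},\,n\in \mathbb{Z}_{\ge 0}} b_{m,n}(\sigma)\, t^{(\sigma +m)^2+n}.$$ Let $m_0$ be the integer closest to $\sigma$. Then, shifting $m$ by an integer, one can write the solution as $$\tau (t)=\sum_{m\in \mathbb{Z},\,n\in \mathbb{Z}_{\ge 0}} b_{m-m_0,n}(\sigma)\, t^{(\sigma-m_0 +m)^2+n},$$ where $|\mathrm{Re}\,\sigma-m_0|<\frac12$. Consequently, formal solutions of the form $\sum_{m\in\mathbb{Z},\,n\in\mathbb{Z}_{\ge0}} b_{m,n}(\sigma)\,t^{(\sigma+m)^2+n}$ converge for any $\sigma$ satisfying $|\mathrm{Re}\,\sigma|\notin \frac12+\mathbb{Z}$.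
   Context: The $\alpha_{N,K,I}$ are constant coefficients. $\delta=t\frac{d}{dt}$. The Hirota derivative with respect to $\delta$ is the bilinear operator $$\mathcal{D}^N_{\log t} f\cdot g:=\sum_{i=0}^N (-1)^i \binom{N}{i}\, \delta^{N-i}f \cdot \delta^i g .$$ Formal series are formal sums of monomials $c\,t^a$ with complex exponents, with $\delta t^a=a\,t^a$ applied termwise; a formal solution is one for which the coefficient of each power of $t$ vanishes after substitution. Convergence means that the formal series has a convergence domain in $\mathbb{C}\setminus\{0\}$ that contains a neighborhood of $0$. "Closest to $\sigma$" refers to the integer closest to $\mathrm{Re}\,\sigma$.
   Formalization: The bound |Re σ − m_0| < 1/2 is claimed only when |Re σ| ∉ 1/2 + Z: in a tie, e.g. σ = 1/2 + i, the closest integer is not unique and the distance is exactly 1/2. The reindexing is stated for every closest integer m_0. *)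

theory Defs
  imports "HOL-Analysis.Analysis"
begin

text \<open>
  A formal series in complex powers of \<open>t\<close> is represented by its coefficient function:
  \<open>f a\<close> is the coefficient of \<open>t\<^sup>a\<close>.
\<close>

type_synonym fseries = "complex \<Rightarrow> complex"

definition fs_of_monomials :: "('i \<Rightarrow> complex) \<Rightarrow> ('i \<Rightarrow> complex) \<Rightarrow> fseries" where
  "fs_of_monomials c e = (\<lambda>a. \<Sum>i | e i = a. c i)"

definition fs_delta :: "fseries \<Rightarrow> fseries" where
  "fs_delta f = (\<lambda>a. a * f a)"

text \<open>
  The product is meaningful only when each coefficient is a finite sum; for the series of
  interest here this is lemma \<open>finite_fs_mult_tau_series\<close> below.
\<close>

definition fs_mult :: "fseries \<Rightarrow> fseries \<Rightarrow> fseries" where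
  "fs_mult f g = (\<lambda>c. \<Sum>a | f a \<noteq> 0 \<and> g (c - a) \<noteq> 0. f a * g (c - a))"

definition fs_times_tpow :: "nat \<Rightarrow> fseries \<Rightarrow> fseries" where
  "fs_times_tpow N f = (\<lambda>c. f (c - of_nat N))"

definition hirota :: "nat \<Rightarrow> fseries \<Rightarrow> fseries \<Rightarrow> fseries" where
  "hirota N f g = (\<lambda>c. \<Sum>i=0..N. (-1) ^ i * of_nat (N choose i) *
     fs_mult ((fs_delta ^^ (N - i)) f) ((fs_delta ^^ i) g) c)"

definition equation_lhs :: "nat \<Rightarrow> (nat \<Rightarrow> nat \<Rightarrow> nat \<Rightarrow> complex) \<Rightarrow> fseries \<Rightarrow> fseries" where
  "equation_lhs N\<^sub>0 \<alpha> f = (\<lambda>c. hirota 4 f f c + hirota 2 f f c - 4 * hirota 2 (fs_delta f) f c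
     + (\<Sum>N=1..N\<^sub>0. \<Sum>K=0..4. \<Sum>I=0..K div 2. \<alpha> N K I *
          fs_times_tpow N (fs_mult ((fs_delta ^^ I) f) ((fs_delta ^^ (K - I)) f)) c))"

definition formal_solution :: "nat \<Rightarrow> (nat \<Rightarrow> nat \<Rightarrow> nat \<Rightarrow> complex) \<Rightarrow> fseries \<Rightarrow> bool" where
  "formal_solution N\<^sub>0 \<alpha> f \<longleftrightarrow> (\<forall>c. equation_lhs N\<^sub>0 \<alpha> f c = 0)"

definition tau_series :: "complex \<Rightarrow> (int \<Rightarrow> nat \<Rightarrow> complex) \<Rightarrow> fseries" where
  "tau_series \<sigma> b = fs_of_monomials (\<lambda>(m, n). b m n) (\<lambda>(m, n). (\<sigma> + of_int m)\<^sup>2 + of_nat n)"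

text \<open>
  Powers \<open>t\<^sup>a\<close> are multivalued; \<open>L\<close> ranges over all logarithms of \<open>t\<close>, so convergence is
  required in a punctured disc for every branch, that is, over the universal cover.
  Summability of complex families is unconditional, hence absolute, convergence.
\<close>

definition fs_converges :: "fseries \<Rightarrow> bool" where
  "fs_converges f \<longleftrightarrow> (\<exists>r>0. \<forall>t L. t \<noteq> 0 \<longrightarrow> norm t < r \<longrightarrow> exp L = t \<longrightarrow>
     (\<lambda>a. f a * exp (a * L)) summable_on UNIV)"

lemma int_eq_if_irrational:
  fixes \<sigma> :: complex
  assumes "\<sigma> \<notin> \<rat>" "of_int p * \<sigma> + of_int q = of_int p' * \<sigma> + of_int q'"
  shows "p = p' \<and> q = q'"
proof -
  have eq: "of_int (p - p') * \<sigma> = of_int (q' - q)"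
    using assms(2) by (simp add: algebra_simps)
  have "p = p'"
  proof (rule ccontr)
    assume "p \<noteq> p'"
    then have "\<sigma> = of_int (q' - q) / of_int (p - p')"
      using eq by (simp add: field_simps)
    also have "\<dots> \<in> \<rat>"
      by (intro Rats_divide Rats_of_int)
    finally show False
      using assms(1) by simp
  qed
  then show ?thesis
    using eq by simp
qed

lemma tau_series_exponent_inj:
  fixes \<sigma> :: complex and m m' :: int and n n' :: nat
  assumes "\<sigma> \<notin> \<rat>" "(\<sigma> + of_int m)\<^sup>2 + of_nat n = (\<sigma> + of_int m')\<^sup>2 + of_nat n'"
  shows "m = m' \<and> n = n'"
proof -
  have "of_int (2 * m) * \<sigma> + of_int (m\<^sup>2 + int n) = of_int (2 * m') * \<sigma> + of_int (m'\<^sup>2 + int n')"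
    using assms(2) by (simp add: power2_eq_square algebra_simps)
  from int_eq_if_irrational[OF assms(1) this] show ?thesis
    by auto
qed

lemma tau_series_coeff:
  assumes "\<sigma> \<notin> \<rat>"
  shows "tau_series \<sigma> b ((\<sigma> + of_int m)\<^sup>2 + of_nat n) = b m n"
proof -
  have "{i. (case i of (m', n') \<Rightarrow> (\<sigma> + of_int m')\<^sup>2 + of_nat n') =
      (\<sigma> + of_int m)\<^sup>2 + of_nat n} = {(m, n)}"
    using tau_series_exponent_inj[OF assms] by auto
  then show ?thesis
    by (simp add: tau_series_def fs_of_monomials_def)
qed

lemma tau_series_support:
  assumes "tau_series \<sigma> b a \<noteq> 0"
  obtains m n where "a = (\<sigma> + of_int m)\<^sup>2 + of_nat n" "b m n \<noteq> 0"
proof -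
  obtain i where "(case i of (m, n) \<Rightarrow> (\<sigma> + of_int m)\<^sup>2 + of_nat n) = a"
      "(case i of (m, n) \<Rightarrow> b m n) \<noteq> 0"
    using assms unfolding tau_series_def fs_of_monomials_def
    by (metis (mono_tags, lifting) mem_Collect_eq sum.neutral)
  then show ?thesis
    using that by (cases i) auto
qed

lemma finite_fs_mult_tau_series:
  assumes "\<sigma> \<notin> \<rat>"
  shows "finite {a. tau_series \<sigma> b a \<noteq> 0 \<and> tau_series \<sigma> b' (c - a) \<noteq> 0}" (is "finite ?S")
proof (cases "?S = {}")
  case False
  have decomp: "\<exists>m n m' n'. a = (\<sigma> + of_int m)\<^sup>2 + of_nat n \<and>
      c - a = (\<sigma> + of_int m')\<^sup>2 + of_nat n'" if "a \<in> ?S" for a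
    using that by (auto elim!: tau_series_support)
  have sum_eq: "2 * \<sigma>\<^sup>2 + (of_int (2 * (m + m')) * \<sigma> + of_int (m\<^sup>2 + m'\<^sup>2 + int n + int n')) = c"
    if "a = (\<sigma> + of_int m)\<^sup>2 + of_nat n" "c - a = (\<sigma> + of_int m')\<^sup>2 + of_nat n'" for a m n m' n'
  proof -
    have "c = a + (c - a)" by simp
    then show ?thesis
      unfolding that(2) unfolding that(1) by (simp add: power2_eq_square algebra_simps)
  qed
  from False obtain a0 where "a0 \<in> ?S" by blast
  from decomp[OF this] obtain m0 n0 m0' n0' where
    0: "a0 = (\<sigma> + of_int m0)\<^sup>2 + of_nat n0" "c - a0 = (\<sigma> + of_int m0')\<^sup>2 + of_nat n0'"
    by blast
  define k where "k = m0\<^sup>2 + m0'\<^sup>2 + int n0 + int n0'"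
  have "?S \<subseteq> (\<lambda>(m, n). (\<sigma> + of_int m)\<^sup>2 + of_nat n) ` ({-k..k} \<times> {..nat k})"
  proof
    fix a assume "a \<in> ?S"
    from decomp[OF this] obtain m n m' n' where
      1: "a = (\<sigma> + of_int m)\<^sup>2 + of_nat n" "c - a = (\<sigma> + of_int m')\<^sup>2 + of_nat n'"
      by blast
    have "of_int (2 * (m + m')) * \<sigma> + of_int (m\<^sup>2 + m'\<^sup>2 + int n + int n') =
        of_int (2 * (m0 + m0')) * \<sigma> + of_int k"
      using sum_eq[OF 0] sum_eq[OF 1] unfolding k_def by (metis add_left_cancel)
    from int_eq_if_irrational[OF assms this] have k: "m\<^sup>2 + m'\<^sup>2 + int n + int n' = k"
      by simp
    have "\<bar>m\<bar> \<le> m\<^sup>2"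
      using self_le_power[of "\<bar>m\<bar>" 2] by (cases "m = 0") auto
    moreover have "0 \<le> m'\<^sup>2" "0 \<le> m\<^sup>2" by simp_all
    ultimately have "\<bar>m\<bar> \<le> k" "int n \<le> k"
      using k by linarith+
    then show "a \<in> (\<lambda>(m, n). (\<sigma> + of_int m)\<^sup>2 + of_nat n) ` ({-k..k} \<times> {..nat k})"
      using 1(1) by (intro image_eqI[of _ _ "(m, n)"]) auto
  qed
  then show ?thesis
    by (rule finite_subset) simp
qed (metis finite.emptyI)

end

theory Submission
  imports Defs
begin

text \<open>
  For every real \<open>s\<close> the weight \<open>(s + m)\<^sup>2 + n\<close> of the exponent \<open>(\<sigma> + m)\<^sup>2 + n\<close> is conserved in
  products: since \<open>\<sigma>\<close> is irrational, equality of two sums of exponents gives equality of the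
  sums of the \<open>m\<close> and of the \<open>m\<^sup>2 + n\<close>. For irrational \<open>s\<close> the weights are pairwise distinct, so
  the support has a unique exponent \<open>e\<close> of least weight, which may be normalised to 0. The
  coefficient of \<open>t\<^sup>a\<^sup>+\<^sup>e\<close> in the equation then determines \<open>f a\<close> quadratically from coefficients of
  smaller weight, for all but finitely many \<open>a\<close>: the factor of \<open>f a * f e\<close> grows like the fourth
  power of the weight, as do all other symbols at most. A majorant argument bounds
  \<open>\<Sum>a. norm (f a) * z powr weight a\<close> for small \<open>z\<close>, and for \<open>norm t < z\<close> the factor \<open>t\<^sup>a\<close> is
  \<open>O(z powr weight a)\<close> on each branch, the weight being quadratic in \<open>m\<close> and the dependence on
  the branch only exponential in \<open>m\<close>.
\<close>

section \<open>The equation as a sum over pairs of exponents\<close>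

text \<open>The pairs of exponents contributing to the coefficient of \<open>t\<close> to the power
  \<open>c\<close> in \<open>f * f\<close>. It serves as a common index set for all bilinear terms,
  whatever powers of \<open>fs_delta\<close> act on the factors.\<close>

definition cross :: "fseries \<Rightarrow> complex \<Rightarrow> complex set" where
  "cross f c = {x. f x \<noteq> 0 \<and> f (c - x) \<noteq> 0}"

text \<open>The factor by which the unshifted part of the equation acts on a pair of monomials with
  exponents \<open>x\<close> and \<open>y\<close>. It is not symmetric, since in the third term
  \<open>fs_delta\<close> acts on the first factor only.\<close>

definition leading_symbol :: "complex \<Rightarrow> complex \<Rightarrow> complex" where
  "leading_symbol x y = (x - y) ^ 4 + (x - y)\<^sup>2 - 4 * x * (x - y)\<^sup>2"

definition shift_symbol :: "(nat \<Rightarrow> nat \<Rightarrow> nat \<Rightarrow> complex) \<Rightarrow> nat \<Rightarrow> complex \<Rightarrow> complex \<Rightarrow> complex" where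
  "shift_symbol \<alpha> N x y = (\<Sum>K=0..4. \<Sum>I=0..K div 2. \<alpha> N K I * x ^ I * y ^ (K - I))"

lemma funpow_fs_delta: "(fs_delta ^^ i) f a = a ^ i * f a"
  by (induction i) (simp_all add: fs_delta_def)

text \<open>The index set in \<open>fs_mult\<close> can be smaller than \<open>cross f c\<close>,
  because \<open>fs_delta\<close> kills the exponent 0 and \<open>u\<close> may vanish; the extra
  terms are then zero. The multiplier \<open>u\<close> covers both \<open>g = f\<close> and
  \<open>g = fs_delta f\<close>.\<close>

lemma fs_mult_funpow_delta:
  assumes "finite (cross f c)" "\<And>a. g a = u a * f a"
  shows "fs_mult ((fs_delta ^^ i) g) ((fs_delta ^^ j) f) c =
    (\<Sum>x\<in>cross f c. x ^ i * u x * (c - x) ^ j * (f x * f (c - x)))"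
  unfolding fs_mult_def
  by (rule sum.mono_neutral_cong_left) (use assms in \<open>auto simp: cross_def funpow_fs_delta\<close>)

text \<open>On a pair of monomials the alternating binomial sum is the binomial expansion of the
  \<open>N\<close>-th power of the difference of exponents.\<close>

lemma hirota_eq_sum:
  assumes "finite (cross f c)" "\<And>a. g a = u a * f a"
  shows "hirota N g f c = (\<Sum>x\<in>cross f c. u x * (x - (c - x)) ^ N * (f x * f (c - x)))"
proof -
  have "hirota N g f c = (\<Sum>i=0..N. \<Sum>x\<in>cross f c.
      (-1) ^ i * of_nat (N choose i) * ((x ^ (N - i) * u x) * (c - x) ^ i * (f x * f (c - x))))"
    unfolding hirota_def
    by (simp add: fs_mult_funpow_delta[OF assms] sum_distrib_left mult.assoc)
  also have "\<dots> = (\<Sum>x\<in>cross f c. \<Sum>i=0..N.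
      (-1) ^ i * of_nat (N choose i) * ((x ^ (N - i) * u x) * (c - x) ^ i * (f x * f (c - x))))"
    by (rule sum.swap)
  also have "\<dots> = (\<Sum>x\<in>cross f c. u x * (x - (c - x)) ^ N * (f x * f (c - x)))"
  proof (rule sum.cong[OF refl])
    fix x
    have "(x - (c - x)) ^ N = (- (c - x) + x) ^ N"
      by simp
    also have "\<dots> = (\<Sum>i=0..N. of_nat (N choose i) * ((-1) ^ i * (c - x) ^ i) * x ^ (N - i))"
      unfolding binomial_ring atLeast0AtMost power_minus[of "c - x"] ..
    finally show "(\<Sum>i=0..N. (-1) ^ i * of_nat (N choose i) *
        ((x ^ (N - i) * u x) * (c - x) ^ i * (f x * f (c - x)))) =
        u x * (x - (c - x)) ^ N * (f x * f (c - x))"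
      by (simp add: sum_distrib_left sum_distrib_right mult_ac)
  qed
  finally show ?thesis .
qed

lemma equation_lhs_eq_sum:
  assumes fin: "\<And>c. finite (cross f c)"
  shows "equation_lhs N\<^sub>0 \<alpha> f c =
    (\<Sum>x\<in>cross f c. leading_symbol x (c - x) * (f x * f (c - x))) +
    (\<Sum>N=1..N\<^sub>0. \<Sum>x\<in>cross f (c - of_nat N).
       shift_symbol \<alpha> N x (c - of_nat N - x) * (f x * f (c - of_nat N - x)))"
proof -
  have "hirota 4 f f c + hirota 2 f f c - 4 * hirota 2 (fs_delta f) f c =
      (\<Sum>x\<in>cross f c. leading_symbol x (c - x) * (f x * f (c - x)))"
    by (subst (1 2) hirota_eq_sum[OF fin, where u = "\<lambda>_. 1"], simp, simp,
        subst hirota_eq_sum[OF fin, where u = "\<lambda>x. x"])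
       (simp_all add: fs_delta_def leading_symbol_def sum.distrib[symmetric] sum_distrib_left
         sum_subtractf[symmetric] algebra_simps)
  moreover have "(\<Sum>K=0..4. \<Sum>I=0..K div 2. \<alpha> N K I *
      fs_times_tpow N (fs_mult ((fs_delta ^^ I) f) ((fs_delta ^^ (K - I)) f)) c) =
      (\<Sum>x\<in>cross f (c - of_nat N).
        shift_symbol \<alpha> N x (c - of_nat N - x) * (f x * f (c - of_nat N - x)))" for N
  proof -
    let ?c = "c - of_nat N"
    have "(\<Sum>K=0..4. \<Sum>I=0..K div 2. \<alpha> N K I *
        fs_times_tpow N (fs_mult ((fs_delta ^^ I) f) ((fs_delta ^^ (K - I)) f)) c) =
        (\<Sum>K=0..4. \<Sum>I=0..K div 2. \<Sum>x\<in>cross f ?c.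
          \<alpha> N K I * x ^ I * (?c - x) ^ (K - I) * (f x * f (?c - x)))"
      unfolding fs_times_tpow_def
      by (simp add: fs_mult_funpow_delta[OF fin, where u = "\<lambda>_. 1"] sum_distrib_left mult_ac)
    also have "\<dots> = (\<Sum>K=0..4. \<Sum>x\<in>cross f ?c. \<Sum>I=0..K div 2.
          \<alpha> N K I * x ^ I * (?c - x) ^ (K - I) * (f x * f (?c - x)))"
      by (intro sum.cong refl sum.swap)
    also have "\<dots> = (\<Sum>x\<in>cross f ?c. \<Sum>K=0..4. \<Sum>I=0..K div 2.
          \<alpha> N K I * x ^ I * (?c - x) ^ (K - I) * (f x * f (?c - x)))"
      by (rule sum.swap)
    finally show ?thesis
      by (simp add: shift_symbol_def sum_distrib_right)
  qed
  ultimately show ?thesis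
    unfolding equation_lhs_def by simp
qed

section \<open>Growth of the symbols\<close>

lemma norm_leading_symbol_le:
  assumes "norm x \<le> V" "norm y \<le> V" "1 \<le> V"
  shows "norm (leading_symbol x y) \<le> 36 * V ^ 4"
proof -
  have d: "norm (x - y) \<le> 2 * V"
    using norm_triangle_ineq4[of x y] assms by linarith
  have "norm (leading_symbol x y) \<le> norm (x - y) ^ 4 + norm (x - y) ^ 2 + 4 * norm x * norm (x - y) ^ 2"
    unfolding leading_symbol_def
    by (rule order.trans[OF norm_triangle_ineq4], rule add_mono[OF order.trans[OF norm_triangle_ineq]])
       (simp_all add: norm_mult norm_power)
  also have "\<dots> \<le> (2 * V) ^ 4 + (2 * V) ^ 2 + 4 * V * (2 * V) ^ 2"
    using d assms by (intro add_mono mult_mono power_mono) auto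
  also have "\<dots> = 16 * V ^ 4 + 4 * V ^ 2 + 16 * V ^ 3"
    by (simp add: power2_eq_square power3_eq_cube)
  also have "\<dots> \<le> 36 * V ^ 4"
    using power_increasing[of 2 4 V] power_increasing[of 3 4 V] assms(3) by simp
  finally show ?thesis .
qed

lemma norm_shift_symbol_le:
  assumes "norm x \<le> V" "norm y \<le> V" "1 \<le> V"
  shows "norm (shift_symbol \<alpha> N x y) \<le> (\<Sum>K=0..4. \<Sum>I=0..K div 2. norm (\<alpha> N K I)) * V ^ 4"
  unfolding shift_symbol_def sum_distrib_right
proof (intro sum_norm_le)
  fix K I :: nat
  assume K: "K \<in> {0..4}" and I: "I \<in> {0..K div 2}"
  have "norm (\<alpha> N K I * x ^ I * y ^ (K - I)) = norm (\<alpha> N K I) * (norm x ^ I * norm y ^ (K - I))"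
    by (simp add: norm_mult norm_power)
  also have "\<dots> \<le> norm (\<alpha> N K I) * (V ^ I * V ^ (K - I))"
    using assms by (intro mult_left_mono mult_mono power_mono) auto
  also have "V ^ I * V ^ (K - I) = V ^ K"
    using I by (simp flip: power_add)
  also have "V ^ K \<le> V ^ 4"
    using K assms by (intro power_increasing) auto
  finally show "norm (\<alpha> N K I * x ^ I * y ^ (K - I)) \<le> norm (\<alpha> N K I) * V ^ 4"
    by (simp add: mult_left_mono)
qed

text \<open>The product \<open>f x * f y\<close> occurs for both orders of the pair, so the
  symmetrised symbol is its true factor. With \<open>d = x - y\<close> it is \<open>2 * d^2\<close>
  times a monic quadratic in \<open>d\<close>, whose lower order terms take at most half of
  \<open>d^2\<close> once \<open>d\<close> is large compared with \<open>y\<close>.\<close>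

lemma norm_leading_symbol_sym_ge:
  assumes "norm (x - y) \<ge> 6 + 8 * norm y"
  shows "norm (leading_symbol x y + leading_symbol y x) \<ge> norm (x - y) ^ 4"
proof -
  define d where "d = x - y"
  have eq: "leading_symbol x y + leading_symbol y x = 2 * d ^ 2 * (d ^ 2 - (2 * d + (4 * y - 1)))"
    unfolding leading_symbol_def d_def by algebra
  have "norm (2 * d + (4 * y - 1)) \<le> 2 * norm d + (4 * norm y + 1)"
    using norm_triangle_ineq[of "2 * d" "4 * y - 1"] norm_triangle_ineq4[of "4 * y" 1]
    by (simp add: norm_mult)
  also have "\<dots> \<le> norm d ^ 2 / 2"
  proof -
    have "norm d * (6 + 8 * norm y) \<le> norm d * norm d"
      using assms by (intro mult_left_mono) (auto simp: d_def)
    moreover have "1 * norm y \<le> norm d * norm y"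
      using order.trans[OF _ assms, of 1] by (intro mult_right_mono) (auto simp: d_def)
    ultimately show ?thesis
      using assms norm_ge_zero[of y] unfolding d_def[symmetric] power2_eq_square ring_distribs by linarith
  qed
  finally have "norm d ^ 2 / 2 \<le> norm (d ^ 2 - (2 * d + (4 * y - 1)))"
    using norm_triangle_ineq2[of "d ^ 2" "2 * d + (4 * y - 1)"] by (simp add: norm_power)
  then have "2 * norm d ^ 2 * (norm d ^ 2 / 2) \<le> 2 * norm d ^ 2 * norm (d ^ 2 - (2 * d + (4 * y - 1)))"
    by (intro mult_left_mono) auto
  then show ?thesis
    unfolding eq by (simp add: norm_mult norm_power d_def[symmetric] flip: power_add)
qed

section \<open>The majorant argument\<close>

text \<open>Induction on weight levels of width \<open>\<delta>\<close>: every term of the recursion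
  refers to lower levels or to \<open>e\<close>. The quadratic part preserves the bound
  \<open>\<epsilon>\<close> because \<open>\<epsilon>\<close> is small; shifted terms and
  exceptional exponents carry a factor at most \<open>Q\<close>, which a small \<open>z\<close>
  makes negligible.\<close>

lemma quadratic_recursion_summable:
  fixes f :: fseries and w :: "complex \<Rightarrow> real"
  assumes fin_w: "\<And>W. finite {a. f a \<noteq> 0 \<and> w a \<le> W}"
    and e: "w e = 0" and pos: "\<And>a. f a \<noteq> 0 \<Longrightarrow> a \<noteq> e \<Longrightarrow> 0 < w a"
    and conserved: "\<And>x y a N. f x \<noteq> 0 \<Longrightarrow> f y \<noteq> 0 \<Longrightarrow> f a \<noteq> 0 \<Longrightarrow>
      x + y + of_nat N = a + e \<Longrightarrow> w x + w y + real N = w a"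
    and fin_cross: "\<And>c. finite (cross f c)"
    and X: "finite X" and C: "0 < C"
    and rec: "\<And>a. f a \<noteq> 0 \<Longrightarrow> a \<noteq> e \<Longrightarrow> a \<notin> X \<Longrightarrow> norm (f a) \<le> C *
      ((\<Sum>x\<in>cross f (a + e) - {a, e}. norm (f x) * norm (f (a + e - x))) +
       (\<Sum>N=1..N\<^sub>0. \<Sum>x\<in>cross f (a + e - of_nat N). norm (f x) * norm (f (a + e - of_nat N - x))))"
  obtains z where "0 < z" "(\<lambda>a. norm (f a) * z powr w a) summable_on UNIV"
proof -
  define A where "A = {a. f a \<noteq> 0 \<and> a \<noteq> e \<and> w a \<le> 1}"
  have finA: "finite A"
    by (rule finite_subset[OF _ fin_w[of 1]]) (auto simp: A_def)
  \<comment> \<open>A lower bound for all weights other than that of \<open>e\<close>. Inserting 1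
    covers empty \<open>A\<close> and keeps \<open>\<delta>\<close> at most 1, so a shift by
    \<open>N \<ge> 1\<close> also lowers the weight by at least \<open>\<delta>\<close>.\<close>
  define \<delta> where "\<delta> = Min (insert 1 (w ` A))"
  have \<delta>: "0 < \<delta>" "\<delta> \<le> 1"
    using finA pos by (auto simp: \<delta>_def A_def)
  have gap: "\<delta> \<le> w a" if "f a \<noteq> 0" "a \<noteq> e" for a
  proof (cases "w a \<le> 1")
    case True
    then show ?thesis
      using that finA by (auto simp: \<delta>_def A_def)
  qed (use \<delta> in linarith)
  \<comment> \<open>Chosen so that the quadratic part uses only a quarter of the allowed
    bound.\<close>
  define \<epsilon> where "\<epsilon> = 1 / (4 * C)"
  have \<epsilon>: "0 < \<epsilon>" "C * \<epsilon>\<^sup>2 = \<epsilon> / 4"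
    using C by (simp_all add: \<epsilon>_def power2_eq_square field_simps)
  define F where "F = (\<Sum>a\<in>X. norm (f a))"
  \<comment> \<open>\<open>M - 1\<close> collects everything multiplied by \<open>Q\<close>: the
    exceptional set through \<open>F\<close>, and the shifted sums. The summand 1 makes division by
    \<open>M\<close> safe.\<close>
  define M where "M = F + C * (real N\<^sub>0 * (norm (f e) + \<epsilon>)\<^sup>2) + 1"
  have F: "0 \<le> F"
    unfolding F_def by (simp add: sum_nonneg)
  have M: "1 \<le> M"
    unfolding M_def using F C by (simp add: zero_le_mult_iff)
  define Q where "Q = min 1 (\<epsilon> / (2 * M))"
  have Q: "0 < Q" "Q \<le> 1" "M * Q \<le> \<epsilon> / 2"
  proof -
    show "0 < Q" "Q \<le> 1"
      using \<epsilon> M by (auto simp: Q_def)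
    have "M * Q \<le> M * (\<epsilon> / (2 * M))"
      using M by (intro mult_left_mono) (auto simp: Q_def)
    then show "M * Q \<le> \<epsilon> / 2"
      using M by simp
  qed
  \<comment> \<open>With this choice, \<open>z powr w a \<le> Q\<close> for every \<open>a\<close>
    of the support other than \<open>e\<close>, by the gap; \<open>\<delta> \<le> 1\<close> gives
    \<open>z \<le> Q\<close> for the shifts.\<close>
  define z where "z = Q powr (1 / \<delta>)"
  have z: "0 < z" "z \<le> 1" "z powr \<delta> = Q"
    using Q \<delta> by (auto simp: z_def powr_powr intro: powr_le1)
  have zQ: "z \<le> Q"
    using powr_mono'[of \<delta> 1 z] z \<delta> by simp
  define g where "g a = norm (f a) * z powr w a" for a
  have g0: "0 \<le> g a" for a
    by (simp add: g_def)
  \<comment> \<open>The exponent \<open>e\<close> is left out: its weight is 0, so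
    \<open>g e = norm (f e)\<close> does not become small with \<open>z\<close>.\<close>
  define T where "T k = {a. f a \<noteq> 0 \<and> a \<noteq> e \<and> w a \<le> real k * \<delta>}" for k :: nat
  have finT: "finite (T k)" for k
    by (rule finite_subset[OF _ fin_w[of "real k * \<delta>"]]) (auto simp: T_def)

  \<comment> \<open>The map \<open>(a, x) \<mapsto> (x, a + e - N - x)\<close> is injective, so the sum is dominated by the full product.\<close>
  have convolution: "(\<Sum>a\<in>T'. z powr w a *
        (\<Sum>x\<in>B a. norm (f x) * norm (f (a + e - of_nat N - x)))) \<le> z ^ N * (sum g U)\<^sup>2"
    if T': "T' \<subseteq> T k" and B: "\<And>a. B a \<subseteq> cross f (a + e - of_nat N)" and U: "finite U"
      and BU: "\<And>a x. a \<in> T' \<Longrightarrow> x \<in> B a \<Longrightarrow> x \<in> U \<and> a + e - of_nat N - x \<in> U"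
    for T' B U k and N :: nat
  proof -
    let ?h = "\<lambda>(a, x). (x, a + e - of_nat N - x)"
    have fin: "finite T'" "\<And>a. finite (B a)"
      using finite_subset[OF T' finT] finite_subset[OF B fin_cross] by auto
    have "(\<Sum>a\<in>T'. z powr w a *
        (\<Sum>x\<in>B a. norm (f x) * norm (f (a + e - of_nat N - x)))) =
        (\<Sum>a\<in>T'. \<Sum>x\<in>B a. z ^ N * (g x * g (a + e - of_nat N - x)))"
      unfolding sum_distrib_left
    proof (intro sum.cong refl)
      fix a x assume a: "a \<in> T'" and x: "x \<in> B a"
      have "w x + w (a + e - of_nat N - x) + real N = w a"
        by (rule conserved) (use a x T' B in \<open>auto simp: T_def cross_def\<close>)
      then have "z powr w a = z powr w x * z powr w (a + e - of_nat N - x) * z ^ N"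
        using z(1) by (simp flip: powr_add powr_realpow)
      then show "z powr w a * (norm (f x) * norm (f (a + e - of_nat N - x))) =
          z ^ N * (g x * g (a + e - of_nat N - x))"
        by (simp add: g_def)
    qed
    also have "\<dots> = z ^ N * (\<Sum>p\<in>Sigma T' B. (\<lambda>(x, y). g x * g y) (?h p))"
      using fin by (simp add: sum.Sigma sum_distrib_left case_prod_unfold)
    also have "(\<Sum>p\<in>Sigma T' B. (\<lambda>(x, y). g x * g y) (?h p)) =
        (\<Sum>(x, y)\<in>?h ` Sigma T' B. g x * g y)"
      by (subst sum.reindex) (auto simp: inj_on_def)
    also have "\<dots> \<le> (\<Sum>(x, y)\<in>U \<times> U. g x * g y)"
      using U BU by (intro sum_mono2) (auto simp: g0)
    also have "\<dots> = (sum g U)\<^sup>2"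
      by (simp add: power2_eq_square sum_product sum.cartesian_product)
    finally show ?thesis
      using z by (simp add: mult_left_mono)
  qed

  have regroup: "(\<Sum>a\<in>A. u a * (C * (p a + (\<Sum>N=1..N\<^sub>0. r a N)))) =
      C * ((\<Sum>a\<in>A. u a * p a) + (\<Sum>N=1..N\<^sub>0. \<Sum>a\<in>A. u a * r a N))"
    for A :: "complex set" and u p :: "complex \<Rightarrow> real" and r
    by (subst sum.swap) (simp add: sum_distrib_left sum.distrib distrib_left mult.left_commute)
  have bound: "sum g (T k) \<le> \<epsilon>" for k
  proof (induction k)
    case 0
    have "T 0 = {}"
      using pos by (force simp: T_def)
    then show ?case
      using \<epsilon> by simp
  next
    case (Suc k)
    let ?T = "T (Suc k)"
    have in_T: "x \<in> T k" if "f x \<noteq> 0" "x \<noteq> e" "a \<in> ?T" "w x + \<delta> \<le> w a" for x a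
      using that by (auto simp: T_def algebra_simps)
    have "sum g (?T \<inter> X) \<le> (\<Sum>a\<in>?T \<inter> X. norm (f a) * Q)"
      using gap z powr_mono'[of \<delta> _ z] by (intro sum_mono) (auto simp: g_def T_def intro!: mult_left_mono)
    also have "\<dots> \<le> F * Q"
      unfolding F_def sum_distrib_right using X Q by (intro sum_mono2) auto
    finally have exceptional: "sum g (?T \<inter> X) \<le> F * Q" .
    \<comment> \<open>Removing \<open>a\<close> and \<open>e\<close> makes both factors differ from
      \<open>e\<close>; each has weight at least \<open>\<delta>\<close>, so the other lies one
      level lower.\<close>
    have main: "(\<Sum>a\<in>?T - X. z powr w a *
        (\<Sum>x\<in>cross f (a + e) - {a, e}. norm (f x) * norm (f (a + e - x)))) \<le> (sum g (T k))\<^sup>2"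
    proof -
      have "x \<in> T k \<and> a + e - x \<in> T k" if a: "a \<in> ?T" and x: "x \<in> cross f (a + e) - {a, e}" for a x
      proof -
        have "w x + w (a + e - x) + real 0 = w a"
          by (rule conserved) (use a x in \<open>auto simp: T_def cross_def\<close>)
        moreover have "f x \<noteq> 0" "f (a + e - x) \<noteq> 0" "x \<noteq> e" "a + e - x \<noteq> e"
          using x by (auto simp: cross_def)
        ultimately show ?thesis
          using gap[of x] gap[of "a + e - x"] by (auto intro!: in_T[OF _ _ a])
      qed
      then have "(\<Sum>a\<in>?T - X. z powr w a * (\<Sum>x\<in>cross f (a + e) - {a, e}.
          norm (f x) * norm (f (a + e - of_nat 0 - x)))) \<le> z ^ 0 * (sum g (T k))\<^sup>2"
        using finT by (intro convolution[of _ "Suc k"]) auto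
      then show ?thesis
        by simp
    qed
    \<comment> \<open>Here a factor may be \<open>e\<close>, so the square involves
      \<open>norm (f e) + \<epsilon>\<close>, which need not be small; the factor
      \<open>z ^ N \<le> Q\<close> compensates.\<close>
    have shifted: "(\<Sum>a\<in>?T - X. z powr w a *
        (\<Sum>x\<in>cross f (a + e - of_nat N). norm (f x) * norm (f (a + e - of_nat N - x)))) \<le>
        Q * (norm (f e) + \<epsilon>)\<^sup>2" if N: "1 \<le> N" for N
    proof -
      have "x \<in> insert e (T k)"
        if a: "a \<in> ?T" and x: "f x \<noteq> 0" "f (a + e - of_nat N - x) \<noteq> 0" for a x
      proof (cases "x = e")
        case False
        have "w x + w (a + e - of_nat N - x) + real N = w a"
          by (rule conserved) (use a x in \<open>auto simp: T_def\<close>)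
        moreover have "0 \<le> w (a + e - of_nat N - x)"
          using pos[OF x(2)] e by (metis less_eq_real_def)
        ultimately show ?thesis
          using N \<delta> False x by (auto intro!: in_T[OF _ _ a])
      qed simp
      note mem = this
      have "x \<in> insert e (T k) \<and> a + e - of_nat N - x \<in> insert e (T k)"
        if "a \<in> ?T" "x \<in> cross f (a + e - of_nat N)" for a x
        using that mem[of a x] mem[of a "a + e - of_nat N - x"] by (auto simp: cross_def)
      then have "(\<Sum>a\<in>?T - X. z powr w a *
          (\<Sum>x\<in>cross f (a + e - of_nat N). norm (f x) * norm (f (a + e - of_nat N - x)))) \<le>
          z ^ N * (sum g (insert e (T k)))\<^sup>2"
        using finT by (intro convolution[of _ "Suc k"]) auto
      also have "\<dots> \<le> Q * (norm (f e) + \<epsilon>)\<^sup>2"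
      proof (intro mult_mono power_mono)
        have "z ^ N \<le> z ^ 1"
          using z N by (intro power_decreasing) auto
        then show "z ^ N \<le> Q"
          using zQ by simp
        have "e \<notin> T k"
          by (simp add: T_def)
        then show "sum g (insert e (T k)) \<le> norm (f e) + \<epsilon>"
          using Suc.IH z finT by (simp add: g_def e)
      qed (use Q in \<open>auto intro!: sum_nonneg g0\<close>)
      finally show ?thesis .
    qed
    have "sum g (?T - X) \<le> (\<Sum>a\<in>?T - X. z powr w a * (C *
      ((\<Sum>x\<in>cross f (a + e) - {a, e}. norm (f x) * norm (f (a + e - x))) +
       (\<Sum>N=1..N\<^sub>0. \<Sum>x\<in>cross f (a + e - of_nat N). norm (f x) * norm (f (a + e - of_nat N - x))))))"
      unfolding g_def
      by (intro sum_mono, subst mult.commute, intro mult_left_mono rec) (auto simp: T_def)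
    also have "\<dots> = C * ((\<Sum>a\<in>?T - X. z powr w a *
        (\<Sum>x\<in>cross f (a + e) - {a, e}. norm (f x) * norm (f (a + e - x)))) +
        (\<Sum>N=1..N\<^sub>0. \<Sum>a\<in>?T - X. z powr w a *
          (\<Sum>x\<in>cross f (a + e - of_nat N). norm (f x) * norm (f (a + e - of_nat N - x)))))"
      by (rule regroup)
    also have "\<dots> \<le> C * ((sum g (T k))\<^sup>2 + (\<Sum>N=1..N\<^sub>0. Q * (norm (f e) + \<epsilon>)\<^sup>2))"
      using C main shifted by (intro mult_left_mono add_mono sum_mono) auto
    also have "\<dots> \<le> C * (\<epsilon>\<^sup>2 + (\<Sum>N=1..N\<^sub>0. Q * (norm (f e) + \<epsilon>)\<^sup>2))"
      using C Suc.IH by (intro mult_left_mono add_right_mono power_mono sum_nonneg g0) auto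
    finally have "sum g (?T - X) \<le> C * (\<epsilon>\<^sup>2 + (\<Sum>N=1..N\<^sub>0. Q * (norm (f e) + \<epsilon>)\<^sup>2))" .
    then have "sum g ?T \<le> F * Q + C * (\<epsilon>\<^sup>2 + (\<Sum>N=1..N\<^sub>0. Q * (norm (f e) + \<epsilon>)\<^sup>2))"
      using exceptional finT by (simp add: sum.Int_Diff[of ?T g X])
    also have "\<dots> = C * \<epsilon>\<^sup>2 + (M - 1) * Q"
      by (simp add: M_def algebra_simps)
    also have "\<dots> \<le> \<epsilon>"
      using \<epsilon> Q by (simp add: algebra_simps)
    finally show ?case .
  qed

  have "g summable_on UNIV"
  proof (rule nonneg_bdd_above_summable_on)
    show "bdd_above (sum g ` {S. S \<subseteq> UNIV \<and> finite S})"
    proof (rule bdd_aboveI, clarify)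
      fix S :: "complex set" assume S: "finite S"
      \<comment> \<open>Every finite set lies in a single level, apart from \<open>e\<close> and
        points outside the support, so the bound uniform in \<open>k\<close> applies.\<close>
      obtain k :: nat where k: "Max (insert 0 (w ` S)) / \<delta> \<le> real k"
        using real_arch_simple by blast
      have "w a \<le> real k * \<delta>" if "a \<in> S" for a
      proof -
        have "w a \<le> Max (insert 0 (w ` S))"
          using S that by (intro Max_ge) auto
        then show ?thesis
          using k \<delta> by (simp add: divide_le_eq)
      qed
      then have "sum g (S \<inter> {a. f a \<noteq> 0}) \<le> sum g (insert e (T k))"
        using S finT by (intro sum_mono2) (auto simp: T_def g0)
      moreover have "sum g S = sum g (S \<inter> {a. f a \<noteq> 0})"
        using S by (intro sum.mono_neutral_right) (auto simp: g_def)
      ultimately have "sum g S \<le> sum g (insert e (T k))"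
        by simp
      also have "\<dots> \<le> g e + \<epsilon>"
        using bound[of k] finT by (simp add: T_def)
      finally show "sum g S \<le> g e + \<epsilon>" .
    qed
  qed (simp add: g0)
  then show ?thesis
    using that[of z] z by (simp add: g_def[abs_def])
qed


section \<open>Solving the equation for a coefficient\<close>

text \<open>In the coefficient at \<open>a + e\<close> the factor of \<open>f a * f e\<close> is at
  least \<open>((1 + w a) / 8) ^ 4\<close> outside \<open>X\<close>, and all other symbols are at
  most \<open>H * V ^ 4\<close> with \<open>V\<close> proportional to \<open>1 + w a\<close>. The
  fourth powers cancel, leaving a constant independent of \<open>a\<close>.\<close>

lemma formal_solution_recursion_bound:
  fixes f :: fseries and w :: "complex \<Rightarrow> real"
  assumes sol: "formal_solution N\<^sub>0 \<alpha> f"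
    and fin_w: "\<And>W. finite {a. f a \<noteq> 0 \<and> w a \<le> W}"
    and e: "w e = 0" "f e \<noteq> 0" and pos: "\<And>a. f a \<noteq> 0 \<Longrightarrow> a \<noteq> e \<Longrightarrow> 0 < w a"
    and conserved: "\<And>x y a N. f x \<noteq> 0 \<Longrightarrow> f y \<noteq> 0 \<Longrightarrow> f a \<noteq> 0 \<Longrightarrow>
      x + y + of_nat N = a + e \<Longrightarrow> w x + w y + real N = w a"
    and fin_cross: "\<And>c. finite (cross f c)"
    and comparable: "\<And>a. f a \<noteq> 0 \<Longrightarrow> norm (a - e - of_real (w a)) \<le> w a / 2 + K"
  obtains X C where "finite X" "0 < C" "\<And>a. f a \<noteq> 0 \<Longrightarrow> a \<noteq> e \<Longrightarrow> a \<notin> X \<Longrightarrow> norm (f a) \<le> C *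
      ((\<Sum>x\<in>cross f (a + e) - {a, e}. norm (f x) * norm (f (a + e - x))) +
       (\<Sum>N=1..N\<^sub>0. \<Sum>x\<in>cross f (a + e - of_nat N). norm (f x) * norm (f (a + e - of_nat N - x))))"
proof -
  have w0: "0 \<le> w a" if "f a \<noteq> 0" for a
    using pos[OF that] e by (cases "a = e") auto
  have K: "0 \<le> K"
    using comparable[of e] e by simp
  \<comment> \<open>The summand 2 absorbs the multiple \<open>3/2\<close> of the weight left by
    \<open>comparable\<close>.\<close>
  define K' where "K' = norm e + K + 2"
  have norm_le: "norm x \<le> K' * (1 + w a)" if "f x \<noteq> 0" "w x \<le> w a" for x a
  proof -
    have "norm x \<le> norm e + norm (of_real (w x) :: complex) + norm (x - e - of_real (w x))"
      using norm_triangle_ineq[of "e + of_real (w x)" "x - e - of_real (w x)"]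
        norm_triangle_ineq[of e "of_real (w x)"] by simp
    also have "\<dots> \<le> norm e + w x + (w x / 2 + K)"
      using comparable[OF that(1)] w0[OF that(1)] by simp
    also have "\<dots> \<le> (norm e + K + 2) * 1 + 2 * w a"
      using that w0[OF that(1)] by simp
    also have "\<dots> \<le> (norm e + K + 2) * 1 + (norm e + K + 2) * w a"
      using K w0[OF that(1)] that(2) by (intro add_left_mono mult_right_mono) auto
    finally show ?thesis
      by (simp add: K'_def distrib_left)
  qed
  define A where "A N = (\<Sum>K=0..4. \<Sum>I=0..K div 2. norm (\<alpha> N K I))" for N
  have A0: "0 \<le> A N" for N
    unfolding A_def by (intro sum_nonneg norm_ge_zero)
  \<comment> \<open>A common bound for all symbols: 36 comes from
    \<open>norm_leading_symbol_le\<close>, the sum dominates each \<open>A N\<close>.\<close>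
  define H where "H = 36 + (\<Sum>N=1..N\<^sub>0. A N)"
  have H: "A N \<le> H" if "N \<in> {1..N\<^sub>0}" for N
    using member_le_sum[OF that, of A] A0 by (simp add: H_def)
  have H36: "36 \<le> H"
    using A0 by (simp add: H_def sum_nonneg)
  \<comment> \<open>Beyond this weight, \<open>w a / 2 - K\<close> exceeds both
    \<open>6 + 8 * norm e\<close>, as \<open>norm_leading_symbol_sym_ge\<close> requires, and
    \<open>(1 + w a) / 8\<close>.\<close>
  define W where "W = 4 * (K + 6 + 8 * norm e)"
  define X where "X = {a. f a \<noteq> 0 \<and> w a \<le> W}"
  \<comment> \<open>4096 is \<open>8 ^ 4\<close>, from the lower bound on the symmetrised
    symbol.\<close>
  define C where "C = 4096 * H * K' ^ 4 / norm (f e)"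
  have K': "2 \<le> K'"
    using K by (simp add: K'_def)
  show ?thesis
  proof (rule that)
    show "finite X"
      unfolding X_def by (rule fin_w)
    show "0 < C"
      using H36 K' e by (auto simp: C_def intro!: divide_pos_pos mult_pos_pos)
    fix a assume a: "f a \<noteq> 0" "a \<noteq> e" "a \<notin> X"
    define P where "P = (\<Sum>x\<in>cross f (a + e) - {a, e}. norm (f x) * norm (f (a + e - x)))"
    define R where "R N = (\<Sum>x\<in>cross f (a + e - of_nat N).
      norm (f x) * norm (f (a + e - of_nat N - x)))" for N
    define V where "V = K' * (1 + w a)"
    have wa: "0 \<le> w a" "W < w a"
      using a w0 by (auto simp: X_def)
    have V: "1 \<le> V"
      using mult_mono[of 1 K' 1 "1 + w a"] K' wa by (simp add: V_def)
    have V4: "V ^ 4 = K' ^ 4 * (1 + w a) ^ 4"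
      by (simp add: V_def power_mult_distrib)
    have mem: "norm x \<le> V" "norm (a + e - of_nat N - x) \<le> V"
      if "x \<in> cross f (a + e - of_nat N)" for x N
    proof -
      have "w x + w (a + e - of_nat N - x) + real N = w a"
        by (rule conserved) (use a that in \<open>auto simp: cross_def\<close>)
      then show "norm x \<le> V" "norm (a + e - of_nat N - x) \<le> V"
        using that w0[of x] w0[of "a + e - of_nat N - x"] unfolding V_def cross_def
        by (auto intro!: norm_le)
    qed
    have P: "norm (\<Sum>x\<in>cross f (a + e) - {a, e}. leading_symbol x (a + e - x) * (f x * f (a + e - x)))
        \<le> H * V ^ 4 * P"
      unfolding P_def sum_distrib_left
    proof (intro sum_norm_le, unfold norm_mult, intro mult_right_mono)
      fix x assume "x \<in> cross f (a + e) - {a, e}"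
      then have "norm (leading_symbol x (a + e - x)) \<le> 36 * V ^ 4"
        using mem[of x 0] V by (intro norm_leading_symbol_le) auto
      also have "\<dots> \<le> H * V ^ 4"
        using H36 V by (intro mult_right_mono) auto
      finally show "norm (leading_symbol x (a + e - x)) \<le> H * V ^ 4" .
    qed simp
    have R: "norm (\<Sum>N=1..N\<^sub>0. \<Sum>x\<in>cross f (a + e - of_nat N).
        shift_symbol \<alpha> N x (a + e - of_nat N - x) * (f x * f (a + e - of_nat N - x)))
        \<le> H * V ^ 4 * (\<Sum>N=1..N\<^sub>0. R N)"
      unfolding R_def sum_distrib_left
    proof (intro sum_norm_le, unfold norm_mult, intro mult_right_mono)
      fix N x assume N: "N \<in> {1..N\<^sub>0}" and "x \<in> cross f (a + e - of_nat N)"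
      then have "norm (shift_symbol \<alpha> N x (a + e - of_nat N - x)) \<le> A N * V ^ 4"
        using mem[of x N] V unfolding A_def by (intro norm_shift_symbol_le) auto
      also have "\<dots> \<le> H * V ^ 4"
        using H[OF N] V by (intro mult_right_mono) auto
      finally show "norm (shift_symbol \<alpha> N x (a + e - of_nat N - x)) \<le> H * V ^ 4" .
    qed simp
    \<comment> \<open>The terms linear in \<open>f a\<close> are the pairs \<open>(a, e)\<close> and \<open>(e, a)\<close> of the unshifted part.\<close>
    define LP where "LP = (\<Sum>x\<in>cross f (a + e) - {a, e}.
      leading_symbol x (a + e - x) * (f x * f (a + e - x)))"
    define LR where "LR = (\<Sum>N=1..N\<^sub>0. \<Sum>x\<in>cross f (a + e - of_nat N).
      shift_symbol \<alpha> N x (a + e - of_nat N - x) * (f x * f (a + e - of_nat N - x)))"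
    have "(\<Sum>x\<in>cross f (a + e). leading_symbol x (a + e - x) * (f x * f (a + e - x))) =
        LP + (\<Sum>x\<in>{a, e}. leading_symbol x (a + e - x) * (f x * f (a + e - x)))"
      unfolding LP_def using a e fin_cross by (intro sum.subset_diff) (auto simp: cross_def)
    moreover have "(\<Sum>x\<in>{a, e}. leading_symbol x (a + e - x) * (f x * f (a + e - x))) =
        (leading_symbol a e + leading_symbol e a) * (f a * f e)"
      using a by (simp add: algebra_simps)
    moreover have "(\<Sum>x\<in>cross f (a + e). leading_symbol x (a + e - x) * (f x * f (a + e - x))) + LR = 0"
      using sol unfolding formal_solution_def equation_lhs_eq_sum[OF fin_cross] LR_def by blast
    ultimately have "(leading_symbol a e + leading_symbol e a) * (f a * f e) = - (LP + LR)"
      unfolding eq_neg_iff_add_eq_0 by (simp add: add_ac)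
    then have "norm (leading_symbol a e + leading_symbol e a) * (norm (f a) * norm (f e)) = norm (LP + LR)"
      by (metis norm_minus_cancel norm_mult)
    also have "\<dots> \<le> H * V ^ 4 * (P + (\<Sum>N=1..N\<^sub>0. R N))"
      using order.trans[OF norm_triangle_ineq add_mono[OF P R]] by (simp add: LP_def LR_def distrib_left)
    finally have upper: "norm (leading_symbol a e + leading_symbol e a) * (norm (f a) * norm (f e)) \<le>
        H * V ^ 4 * (P + (\<Sum>N=1..N\<^sub>0. R N))" .
    have lower: "((1 + w a) / 8) ^ 4 \<le> norm (leading_symbol a e + leading_symbol e a)"
    proof -
      have "norm (of_real (w a) :: complex) - norm (a - e - of_real (w a)) \<le> norm (a - e)"
        using norm_triangle_ineq4[of "a - e" "a - e - of_real (w a)"] by simp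
      then have d: "w a / 2 - K \<le> norm (a - e)"
        using comparable[OF a(1)] wa by simp
      have W: "24 + 32 * norm e + 4 * K < w a"
        using wa by (simp add: W_def)
      have lin: "(1 + w a) / 8 \<le> norm (a - e)"
        using d W K norm_ge_zero[of e] unfolding add_divide_distrib by linarith
      have far: "6 + 8 * norm e \<le> norm (a - e)"
        using d W K norm_ge_zero[of e] by linarith
      have "((1 + w a) / 8) ^ 4 \<le> norm (a - e) ^ 4"
        using lin wa by (intro power_mono) auto
      also have "\<dots> \<le> norm (leading_symbol a e + leading_symbol e a)"
        by (rule norm_leading_symbol_sym_ge[OF far])
      finally show ?thesis .
    qed
    have "((1 + w a) / 8) ^ 4 * (norm (f a) * norm (f e)) \<le> H * V ^ 4 * (P + (\<Sum>N=1..N\<^sub>0. R N))"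
      by (rule order.trans[OF mult_right_mono[OF lower] upper]) simp
    then have "(1 + w a) ^ 4 * (norm (f a) * norm (f e)) \<le>
        (1 + w a) ^ 4 * (4096 * H * K' ^ 4 * (P + (\<Sum>N=1..N\<^sub>0. R N)))"
      by (simp add: V4 power_divide algebra_simps)
    then have "norm (f a) * norm (f e) \<le> 4096 * H * K' ^ 4 * (P + (\<Sum>N=1..N\<^sub>0. R N))"
      using wa by (subst (asm) mult_le_cancel_left_pos) auto
    then show "norm (f a) \<le> C *
      ((\<Sum>x\<in>cross f (a + e) - {a, e}. norm (f x) * norm (f (a + e - x))) +
       (\<Sum>N=1..N\<^sub>0. \<Sum>x\<in>cross f (a + e - of_nat N). norm (f x) * norm (f (a + e - of_nat N - x))))"
      using e unfolding C_def P_def[symmetric] R_def[symmetric] by (simp add: pos_le_divide_eq)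
  qed
qed

section \<open>Weights of the exponents and convergence on every branch\<close>

lemma tau_series_converges:
  assumes \<sigma>: "\<sigma> \<notin> \<rat>" and sol: "formal_solution N\<^sub>0 \<alpha> (tau_series \<sigma> b)"
  shows "fs_converges (tau_series \<sigma> b)"
proof (cases "\<exists>a. tau_series \<sigma> b a \<noteq> 0")
  case False
  then show ?thesis
    by (auto simp: fs_converges_def intro!: exI[of _ 1])
next
  case True
  define f where "f = tau_series \<sigma> b"
  obtain a\<^sub>1 where a\<^sub>1: "f a\<^sub>1 \<noteq> 0"
    using True by (auto simp: f_def)
  have "\<exists>k. f a \<noteq> 0 \<longrightarrow> a = (\<sigma> + of_int (fst k))\<^sup>2 + of_nat (snd k)" for a
    unfolding f_def by (metis tau_series_support fst_conv snd_conv)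
  then obtain k where "\<And>a. f a \<noteq> 0 \<longrightarrow> a = (\<sigma> + of_int (fst (k a)))\<^sup>2 + of_nat (snd (k a))"
    by metis
  then obtain p q where pq: "\<And>a. f a \<noteq> 0 \<Longrightarrow> a = (\<sigma> + of_int (p a))\<^sup>2 + of_nat (q a)"
    using that[of "\<lambda>a. fst (k a)" "\<lambda>a. snd (k a)"] by blast
  \<comment> \<open>Irrationality of \<open>s\<close> makes \<open>u\<close> injective on the
    support, hence its minimiser unique.\<close>
  obtain s :: real where s: "s \<notin> \<rat>"
    using countable_rat uncountable_UNIV_real by (metis UNIV_eq_I)
  define u where "u a = (of_int (p a) + s)\<^sup>2 + real (q a)" for a
  have fin_u: "finite {a. f a \<noteq> 0 \<and> u a \<le> W}" for W
  proof -
    define k where "k = \<lceil>W + \<bar>s\<bar> + 1\<rceil>"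
    have "{a. f a \<noteq> 0 \<and> u a \<le> W} \<subseteq> (\<lambda>(m, n). (\<sigma> + of_int m)\<^sup>2 + of_nat n) ` ({-k..k} \<times> {..nat k})"
    proof clarify
      fix a assume a: "f a \<noteq> 0" "u a \<le> W"
      define x where "x = of_int (p a) + s"
      have "x\<^sup>2 + real (q a) \<le> W"
        using a by (simp add: u_def x_def)
      moreover have "2 * \<bar>x\<bar> \<le> x\<^sup>2 + 1"
        using sum_squares_bound[of "\<bar>x\<bar>" 1] by simp
      ultimately have "\<bar>x\<bar> \<le> W + 1" and "real (q a) \<le> W"
        using abs_ge_zero[of x] zero_le_power2[of x] of_nat_0_le_iff[where 'a = real, of "q a"] by argo+
      moreover have "\<bar>of_int (p a)\<bar> \<le> \<bar>x\<bar> + \<bar>s\<bar>"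
        unfolding x_def by linarith
      ultimately have "\<bar>of_int (p a)\<bar> \<le> W + \<bar>s\<bar> + 1" "real (q a) \<le> W + \<bar>s\<bar> + 1"
        by linarith+
      then have "\<bar>p a\<bar> \<le> k" "int (q a) \<le> k"
        unfolding k_def by linarith+
      then show "a \<in> (\<lambda>(m, n). (\<sigma> + of_int m)\<^sup>2 + of_nat n) ` ({-k..k} \<times> {..nat k})"
        using pq[OF a(1)] by (intro image_eqI[of _ _ "(p a, q a)"]) auto
    qed
    then show ?thesis
      by (rule finite_subset) simp
  qed
  \<comment> \<open>A minimum over the finite sublevel set of one support point is a minimum over
    the whole support.\<close>
  have "\<exists>e. is_arg_min u (\<lambda>x. x \<in> {a. f a \<noteq> 0 \<and> u a \<le> u a\<^sub>1}) e"
    using fin_u[of "u a\<^sub>1"] a\<^sub>1 by (intro ex_is_arg_min_if_finite) auto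
  then obtain e where e: "f e \<noteq> 0" and min: "\<And>a. f a \<noteq> 0 \<Longrightarrow> u e \<le> u a"
    unfolding is_arg_min_def by (smt (verit) mem_Collect_eq)
  define w where "w a = u a - u e" for a
  have inj: "a = a'" if "u a = u a'" "f a \<noteq> 0" "f a' \<noteq> 0" for a a'
  proof -
    have "complex_of_real (u a) = complex_of_real (u a')"
      using that by simp
    then have "(complex_of_real s + of_int (p a))\<^sup>2 + of_nat (q a) =
        (complex_of_real s + of_int (p a'))\<^sup>2 + of_nat (q a')"
      by (simp add: u_def add.commute)
    then have "p a = p a'" "q a = q a'"
      using tau_series_exponent_inj[of "complex_of_real s"] s by auto
    then show ?thesis
      using pq that by metis
  qed
  have pos: "0 < w a" if "f a \<noteq> 0" "a \<noteq> e" for a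
    using min[OF that(1)] inj[of a e] that e by (auto simp: w_def less_le)
  have conserved: "w x + w y + real N = w a"
    if "f x \<noteq> 0" "f y \<noteq> 0" "f a \<noteq> 0" and eq: "x + y + of_nat N = a + e" for x y a N
  proof -
    \<comment> \<open>Both sides contain \<open>2 * \<sigma>^2\<close>, which cancels; what remains
      is affine in \<open>\<sigma>\<close> with integer coefficients.\<close>
    have *: "of_int (2 * (p x + p y)) * \<sigma> + of_int ((p x)\<^sup>2 + (p y)\<^sup>2 + int (q x) + int (q y) + int N) =
        of_int (2 * (p a + p e)) * \<sigma> + of_int ((p a)\<^sup>2 + (p e)\<^sup>2 + int (q a) + int (q e))"
    proof -
      have "((\<sigma> + of_int (p x))\<^sup>2 + of_nat (q x)) + ((\<sigma> + of_int (p y))\<^sup>2 + of_nat (q y)) + of_nat N =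
          ((\<sigma> + of_int (p a))\<^sup>2 + of_nat (q a)) + ((\<sigma> + of_int (p e))\<^sup>2 + of_nat (q e))"
        using eq pq[OF that(1)] pq[OF that(2)] pq[OF that(3)] pq[OF e] by argo
      then show ?thesis
        by (simp add: power2_eq_square algebra_simps)
    qed
    from int_eq_if_irrational[OF \<sigma> *]
    have lin: "p x + p y = p a + p e"
      and quad: "(p x)\<^sup>2 + (p y)\<^sup>2 + int (q x) + int (q y) + int N = (p a)\<^sup>2 + (p e)\<^sup>2 + int (q a) + int (q e)"
      by auto
    have "real_of_int (p x) + of_int (p y) = of_int (p a) + of_int (p e)"
      using lin by (metis of_int_add)
    then have "2 * s * (real_of_int (p x) + of_int (p y)) = 2 * s * (of_int (p a) + of_int (p e))"
      by simp
    moreover have "real_of_int ((p x)\<^sup>2 + (p y)\<^sup>2 + int (q x) + int (q y) + int N) =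
        real_of_int ((p a)\<^sup>2 + (p e)\<^sup>2 + int (q a) + int (q e))"
      using quad by simp
    ultimately show ?thesis
      by (simp add: w_def u_def power2_eq_square algebra_simps)
  qed
  \<comment> \<open>The difference \<open>a - e - w a\<close> is linear in \<open>j\<close>, while
    \<open>w a\<close> is quadratic. This \<open>c\<close> collects the linear terms, and
    \<open>2 * c * \<bar>j\<bar> \<le> c^2 + j^2\<close> absorbs them; \<open>K\<close> is the
    constant left over.\<close>
  define c where "c = \<bar>s + of_int (p e)\<bar> + norm (2 * (\<sigma> - of_real s))"
  define K where "K = c\<^sup>2 / 2 + real (q e) / 2"
  have comparable: "norm (a - e - of_real (w a)) \<le> w a / 2 + K" if "f a \<noteq> 0" for a
  proof -
    define j where "j = real_of_int (p a) - of_int (p e)"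
    have w_eq: "w a = j\<^sup>2 + 2 * ((s + of_int (p e)) * j) + real (q a) - real (q e)"
      by (simp add: w_def u_def j_def power2_eq_square algebra_simps)
    have "a - e = ((\<sigma> + of_int (p a))\<^sup>2 + of_nat (q a)) - ((\<sigma> + of_int (p e))\<^sup>2 + of_nat (q e))"
      using pq[OF that] pq[OF e] by argo
    then have "a - e - of_real (w a) = 2 * (\<sigma> - of_real s) * of_real j"
      by (simp add: w_def u_def j_def power2_eq_square algebra_simps)
    then have "norm (a - e - of_real (w a)) = norm (2 * (\<sigma> - of_real s)) * \<bar>j\<bar>"
      by (simp only: norm_mult norm_of_real)
    moreover have "- (\<bar>s + of_int (p e)\<bar> * \<bar>j\<bar>) \<le> (s + of_int (p e)) * j"
      by (metis abs_ge_minus_self abs_mult minus_le_iff)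
    moreover have "2 * (\<bar>s + of_int (p e)\<bar> * \<bar>j\<bar> + norm (2 * (\<sigma> - of_real s)) * \<bar>j\<bar>) \<le> c\<^sup>2 + j\<^sup>2"
      using sum_squares_bound[of c "\<bar>j\<bar>"] by (simp add: c_def distrib_right)
    ultimately show ?thesis
      unfolding w_eq K_def using of_nat_0_le_iff[where 'a = real, of "q a"] by argo
  qed
  have fin_w: "finite {a. f a \<noteq> 0 \<and> w a \<le> W}" for W
    using fin_u[of "W + u e"] by (simp add: w_def diff_le_eq)
  have fin_cross: "finite (cross f c)" for c
    unfolding cross_def f_def by (rule finite_fs_mult_tau_series[OF \<sigma>])
  have w_e: "w e = 0"
    by (simp add: w_def)
  obtain X C where "finite X" "0 < C" "\<And>a. f a \<noteq> 0 \<Longrightarrow> a \<noteq> e \<Longrightarrow> a \<notin> X \<Longrightarrow> norm (f a) \<le> C *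
      ((\<Sum>x\<in>cross f (a + e) - {a, e}. norm (f x) * norm (f (a + e - x))) +
       (\<Sum>N=1..N\<^sub>0. \<Sum>x\<in>cross f (a + e - of_nat N). norm (f x) * norm (f (a + e - of_nat N - x))))"
    using formal_solution_recursion_bound[OF sol[folded f_def] fin_w w_e e pos conserved fin_cross comparable]
    by blast
  then obtain z where z: "0 < z" "(\<lambda>a. norm (f a) * z powr w a) summable_on UNIV"
    using quadratic_recursion_summable[OF fin_w w_e pos conserved fin_cross] by blast
  have "(\<lambda>a. f a * exp (a * L)) summable_on UNIV" if L: "norm (exp L) < z" for L :: complex
  proof -
    \<comment> \<open>\<open>Re (a * L) - w a * ln z\<close> is a quadratic in \<open>m\<close> with
      leading coefficient \<open>-g\<close> and linear coefficient \<open>2 * l\<close>. Completing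
      the square bounds it by \<open>D\<close>, which depends on the branch \<open>L\<close> but not
      on \<open>a\<close>.\<close>
    define g where "g = ln z - Re L"
    have g: "0 < g"
      using L z ln_less_cancel_iff[of "exp (Re L)" z] by (simp add: g_def)
    define l where "l = Re (\<sigma> * L) - s * ln z"
    define D where "D = l\<^sup>2 / g + Re (\<sigma>\<^sup>2 * L) - ln z * s\<^sup>2 + u e * ln z"
    have "norm (exp (a * L)) \<le> exp D * z powr w a" if "f a \<noteq> 0" for a
    proof -
      define m where "m = real_of_int (p a)"
      have "a * L = ((\<sigma> + of_real m)\<^sup>2 + of_real (real (q a))) * L"
        using pq[OF that] by (simp add: m_def)
      also have "\<dots> = of_real (m\<^sup>2 + real (q a)) * L + of_real (2 * m) * (\<sigma> * L) + \<sigma>\<^sup>2 * L"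
        by (simp add: power2_eq_square algebra_simps)
      finally have "Re (a * L) = (m\<^sup>2 + real (q a)) * Re L + 2 * m * Re (\<sigma> * L) + Re (\<sigma>\<^sup>2 * L)"
        by (simp only: plus_complex.simps scaleR_complex.simps flip: scaleR_conv_of_real)
      also have "\<dots> = 2 * l * m - g * m\<^sup>2 - l\<^sup>2 / g - g * real (q a) + (D + w a * ln z)"
        unfolding D_def l_def g_def w_def u_def m_def[symmetric] by (simp add: power2_eq_square algebra_simps)
      also have "\<dots> \<le> D + w a * ln z"
      proof -
        have "2 * l * m - g * m\<^sup>2 - l\<^sup>2 / g = - ((g * m - l)\<^sup>2 / g)"
          using g by (simp add: power2_eq_square field_simps)
        moreover have "0 \<le> (g * m - l)\<^sup>2 / g" "0 \<le> g * real (q a)"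
          using g by simp_all
        ultimately show ?thesis
          by linarith
      qed
      finally have "exp (Re (a * L)) \<le> exp (D + w a * ln z)"
        by simp
      then show ?thesis
        using z by (simp add: exp_add powr_def)
    qed
    then have le: "norm (f a * exp (a * L)) \<le> exp D * (norm (f a) * z powr w a)" for a
      by (cases "f a = 0") (auto simp: norm_mult mult.left_commute intro: mult_left_mono)
    show ?thesis
      by (rule abs_summable_summable,
          rule Infinite_Sum.abs_summable_on_comparison_test'[OF summable_on_cmult_right[OF z(2), of "exp D"]])
         (rule le)
  qed
  then show ?thesis
    unfolding fs_converges_def f_def[symmetric] using z(1) by (intro exI[of _ z]) auto
qed

section \<open>Shifting the index by the closest integer\<close>

lemma tau_series_shift:
  "tau_series (\<sigma> - of_int k) (\<lambda>m n. b (m - k) n) = tau_series \<sigma> b"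
proof
  fix a
  show "tau_series (\<sigma> - of_int k) (\<lambda>m n. b (m - k) n) a = tau_series \<sigma> b a"
    unfolding tau_series_def fs_of_monomials_def
    by (rule sum.reindex_bij_witness[where i = "\<lambda>(m, n). (m + k, n)" and j = "\<lambda>(m, n). (m - k, n)"])
       (auto simp: algebra_simps)
qed

lemma closest_int_dist_less_half:
  fixes x :: real
  assumes closest: "\<And>j :: int. \<bar>x - of_int k\<bar> \<le> \<bar>x - of_int j\<bar>" and "\<bar>x\<bar> \<notin> (+) (1/2) ` \<int>"
  shows "\<bar>x - of_int k\<bar> < 1/2"
proof -
  have "\<bar>x - of_int k\<bar> \<noteq> 1/2"
  proof
    assume "\<bar>x - of_int k\<bar> = 1/2"
    \<comment> \<open>The four cases are the signs of \<open>x\<close> and of \<open>x - k\<close>,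
      each written as \<open>1/2\<close> plus an integer.\<close>
    then have "\<bar>x\<bar> = 1/2 + of_int k \<or> \<bar>x\<bar> = 1/2 + of_int (k - 1) \<or>
        \<bar>x\<bar> = 1/2 + of_int (- k) \<or> \<bar>x\<bar> = 1/2 + of_int (- k - 1)"
      by (auto simp: abs_if split: if_splits)
    then show False
      using assms(2) Ints_of_int by blast
  qed
  moreover have "\<bar>x - of_int k\<bar> \<le> 1/2"
    using closest[of "round x"] of_int_round_abs_le[of x] by linarith
  ultimately show ?thesis
    by linarith
qed

theorem mainTheorem3:
  fixes N\<^sub>0 :: nat
    and \<alpha> :: "nat \<Rightarrow> nat \<Rightarrow> nat \<Rightarrow> complex"
    and \<sigma> :: complex
    and b :: "int \<Rightarrow> nat \<Rightarrow> complex \<Rightarrow> complex"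
  assumes "N\<^sub>0 \<ge> 1"
    and "\<sigma> \<notin> \<rat>"
    and "formal_solution N\<^sub>0 \<alpha> (tau_series \<sigma> (\<lambda>m n. b m n \<sigma>))"
  shows "(\<forall>m\<^sub>0 :: int. (\<forall>k :: int. \<bar>Re \<sigma> - of_int m\<^sub>0\<bar> \<le> \<bar>Re \<sigma> - of_int k\<bar>) \<longrightarrow>
            tau_series \<sigma> (\<lambda>m n. b m n \<sigma>) =
              tau_series (\<sigma> - of_int m\<^sub>0) (\<lambda>m n. b (m - m\<^sub>0) n \<sigma>) \<and>
            (\<bar>Re \<sigma>\<bar> \<notin> (+) (1/2) ` \<int> \<longrightarrow> \<bar>Re \<sigma> - of_int m\<^sub>0\<bar> < 1/2)) \<and>
         (\<bar>Re \<sigma>\<bar> \<notin> (+) (1/2) ` \<int> \<longrightarrow> fs_converges (tau_series \<sigma> (\<lambda>m n. b m n \<sigma>)))"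
proof (intro conjI allI impI)
  fix m\<^sub>0 :: int
  show "tau_series \<sigma> (\<lambda>m n. b m n \<sigma>) = tau_series (\<sigma> - of_int m\<^sub>0) (\<lambda>m n. b (m - m\<^sub>0) n \<sigma>)"
    by (rule tau_series_shift[of \<sigma> m\<^sub>0 "\<lambda>m n. b m n \<sigma>", symmetric])
  assume "\<forall>k :: int. \<bar>Re \<sigma> - of_int m\<^sub>0\<bar> \<le> \<bar>Re \<sigma> - of_int k\<bar>" "\<bar>Re \<sigma>\<bar> \<notin> (+) (1/2) ` \<int>"
  then show "\<bar>Re \<sigma> - of_int m\<^sub>0\<bar> < 1/2"
    by (intro closest_int_dist_less_half) auto
next
  show "fs_converges (tau_series \<sigma> (\<lambda>m n. b m n \<sigma>))"
    by (rule tau_series_converges) fact+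
qed

end
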